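(* Let $N$ be a finite set, let $(K,V)$ be a finite simplicial complex, and let $f:K\rightarrow PN$ be a subdivision of the simplex $PN=(PN,N)$, where $PN$ is the set of all subsets of $N$. Let $I$ be a finite nonempty set and let $\{c_i\}_{i\in I}$ be a family of Sperner colorings for the subdivision $f$. Then for every collection $\{m_i\}_{i\in I}$ of nonnegative integers with $\sum_{i\in I}m_i=|N|-1$ there is a face $\sigma\in K$ such that $|c_i(\sigma)|>m_i$ for every $i\in I$ and $\bigcup_{i\in I} c_i(\sigma)=N$.
   Context: A finite simplicial complex is a pair $(K,V)$ with $V$ a finite set of vertices and $K\subseteq PV=\{S\mid S\subseteq V\}$ a set of faces closed under inclusion: if $A\subseteq B\in K$ then $A\in K$. For a finite set $N$, $PN=(PN,N)$ denotes the full simplex on $N$, whose faces are all subsets of $N$. The geometric realization of $(K,V)$ is the subspace of $\mathbb{R}^V$ given by $$|K|=\Big\{k:V\rightarrow\mathbb{R}_{\geq 0}\ \Big|\ \sum_{v\in V}k(v)=1,\ k^{-1}(\mathbb{R}_{>0})\in K\Big\}.$$ A map between finite simplicial complexes $(K,V)$ and $(K',V')$ is any order preserving map $f:K\rightarrow K'$, meaning that if $A\subseteq B\in K$ then $f(A)\subseteq f(B)\in K'$. The map $f$ is simplicial if it is induced by a vertex map $f_0:V\rightarrow V'$ in the sense that $f(A)=\{f_0(v)\mid v\in A\}$ for every $A\in K$. A map $f:K\rightarrow K'$ is a subdivision if there is a homeomorphism $h_f:|K|\rightarrow|K'|$ inducing $f$ in the sense that $(h_f(k))^{-1}(\mathbb{R}_{>0})=f(k^{-1}(\mathbb{R}_{>0}))$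 for every $k\in|K|$. For maps $f,f':K\rightarrow K'$ write $f\leq f'$, and call $f$ a specialization of $f'$, if $f(A)\subseteq f'(A)$ for every $A\in K$. A Sperner coloring for a subdivision $f$ is a simplicial map $c:K\rightarrow K'$ with $c\leq f$, i.e. a simplicial specialization of $f$. *)

theory Defs
  imports "HOL-Analysis.Analysis"
begin

text \<open>
  A complex \<open>(K, V)\<close> is passed as two separate arguments. A vertex \<open>v \<in> V\<close> need
  not satisfy \<open>{v} \<in> K\<close>, and the empty face belongs to \<open>K\<close> unless \<open>K = {}\<close>.
\<close>

definition finite_simplicial_complex :: "'a set set \<Rightarrow> 'a set \<Rightarrow> bool" where
  "finite_simplicial_complex K V \<longleftrightarrow>
     finite V \<and> K \<subseteq> Pow V \<and> (\<forall>A B. A \<subseteq> B \<and> B \<in> K \<longrightarrow> A \<in> K)"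

definition pos_support :: "'a set \<Rightarrow> ('a \<Rightarrow> real) \<Rightarrow> 'a set" where
  "pos_support V k = {v \<in> V. k v > 0}"

text \<open>
  Elements of \<open>\<real>\<^sup>V\<close> are represented by functions that are \<open>undefined\<close> outside \<open>V\<close>; this is the
  carrier convention of \<^const>\<open>product_topology\<close>.
\<close>

definition realization_set :: "'a set set \<Rightarrow> 'a set \<Rightarrow> ('a \<Rightarrow> real) set" where
  "realization_set K V =
     {k \<in> V \<rightarrow>\<^sub>E {0..}. (\<Sum>v\<in>V. k v) = 1 \<and> pos_support V k \<in> K}"

definition geometric_realization :: "'a set set \<Rightarrow> 'a set \<Rightarrow> ('a \<Rightarrow> real) topology" where
  "geometric_realization K V = subtopology (powertop_real V) (realization_set K V)"

text \<open>
  Maps of complexes act on faces; their values outside \<open>K\<close> are irrelevant.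
\<close>

definition complex_map :: "'a set set \<Rightarrow> 'b set set \<Rightarrow> ('a set \<Rightarrow> 'b set) \<Rightarrow> bool" where
  "complex_map K K' f \<longleftrightarrow> (\<forall>A B. A \<subseteq> B \<and> B \<in> K \<longrightarrow> f A \<subseteq> f B \<and> f B \<in> K')"

definition simplicial_map_on ::
  "'a set set \<Rightarrow> 'a set \<Rightarrow> 'b set set \<Rightarrow> 'b set \<Rightarrow> ('a set \<Rightarrow> 'b set) \<Rightarrow> bool" where
  "simplicial_map_on K V K' V' f \<longleftrightarrow>
     complex_map K K' f \<and> (\<exists>f0 \<in> V \<rightarrow> V'. \<forall>A\<in>K. f A = f0 ` A)"

definition subdivision ::
  "'a set set \<Rightarrow> 'a set \<Rightarrow> 'b set set \<Rightarrow> 'b set \<Rightarrow> ('a set \<Rightarrow> 'b set) \<Rightarrow> bool" where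
  "subdivision K V K' V' f \<longleftrightarrow>
     complex_map K K' f \<and>
     (\<exists>h. homeomorphic_map (geometric_realization K V) (geometric_realization K' V') h \<and>
          (\<forall>k \<in> realization_set K V. pos_support V' (h k) = f (pos_support V k)))"

definition specialization ::
  "'a set set \<Rightarrow> ('a set \<Rightarrow> 'b set) \<Rightarrow> ('a set \<Rightarrow> 'b set) \<Rightarrow> bool" where
  "specialization K f f' \<longleftrightarrow> (\<forall>A\<in>K. f A \<subseteq> f' A)"

definition sperner_coloring ::
  "'a set set \<Rightarrow> 'a set \<Rightarrow> 'b set set \<Rightarrow> 'b set \<Rightarrow> ('a set \<Rightarrow> 'b set) \<Rightarrow> ('a set \<Rightarrow> 'b set) \<Rightarrow> bool" where
  "sperner_coloring K V K' V' f c \<longleftrightarrow> simplicial_map_on K V K' V' c \<and> specialization K c f"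

end

theory Submission
  imports Defs
begin

text \<open>
  Extend each coloring \<open>c\<^sub>i\<close> affinely to \<open>|K|\<close>, average these extensions with weights
  \<open>t\<^sub>i = (m\<^sub>i + 1 / |I|) / |N|\<close>, and precompose with the inverse of the homeomorphism of the
  subdivision. The resulting self-map of the simplex preserves faces, hence is onto by Brouwer, and
  so hits the barycenter at some point with supporting face \<open>\<sigma>\<close> of \<open>K\<close>. There the weighted
  contributions \<open>t\<^sub>i a\<^sub>i\<^sub>v\<close> form a nonnegative matrix with row sums
  \<open>t\<^sub>i > m\<^sub>i / |N|\<close> and column sums \<open>1 / |N|\<close>, whose entries vanish unless
  \<open>v \<in> c\<^sub>i(\<sigma>)\<close>. So row \<open>i\<close> has more than \<open>m\<^sub>i\<close> nonzero entries and no column is zero.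
\<close>

section \<open>Poincare-Miranda on the cube via Kuhn's lemma\<close>

text \<open>
  Working in \<open>nat \<Rightarrow> real\<close> avoids dimensions given by types: only the first \<open>n\<close> coordinates
  matter, while the whole Hilbert cube is compact and metrizable.
\<close>

lemma poincare_miranda:
  fixes g :: "nat \<Rightarrow> (nat \<Rightarrow> real) \<Rightarrow> real"
  defines "C \<equiv> UNIV \<rightarrow>\<^sub>E {0..1::real}"
  assumes cont: "\<And>i. i < n \<Longrightarrow> continuous_on C (g i)"
    and low: "\<And>i x. i < n \<Longrightarrow> x \<in> C \<Longrightarrow> x i = 0 \<Longrightarrow> g i x \<ge> 0"
    and high: "\<And>i x. i < n \<Longrightarrow> x \<in> C \<Longrightarrow> x i = 1 \<Longrightarrow> g i x \<le> 0"
  shows "\<exists>x\<in>C. \<forall>i<n. g i x = 0"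
proof -
  have C_iff: "x \<in> C \<longleftrightarrow> (\<forall>i. 0 \<le> x i \<and> x i \<le> 1)" for x
    by (auto simp: C_def PiE_iff)
  \<comment> \<open>Approximate common zero at mesh \<open>1 / Suc k\<close>: each
    \<open>g i\<close> takes both weak signs close to one point \<open>z\<close>. Letting
    \<open>k\<close> grow, the points \<open>z\<close> subconverge to a genuine zero.\<close>
  have "\<exists>z\<in>C. \<forall>i<n. \<exists>a\<in>C. \<exists>b\<in>C. g i a \<ge> 0 \<and> g i b \<le> 0 \<and>
      (\<forall>j. \<bar>a j - z j\<bar> \<le> 1 / Suc k \<and> \<bar>b j - z j\<bar> \<le> 1 / Suc k)" for k
  proof -
    \<comment> \<open>Coordinates from \<open>n\<close> on are frozen at 0, so all grid points agree
      there and closeness holds in every coordinate.\<close>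
    define pt :: "(nat \<Rightarrow> nat) \<Rightarrow> nat \<Rightarrow> real"
      where "pt q j = (if j < n then real (q j) / Suc k else 0)" for q j
    \<comment> \<open>Labels record the sign of \<open>g i\<close>. Kuhn's lemma demands 0 on the
      face \<open>q i = 0\<close> and 1 on the opposite face, which the formula forces;
      \<open>low\<close> and \<open>high\<close> keep the forced labels consistent with the
      sign.\<close>
    define label :: "(nat \<Rightarrow> nat) \<Rightarrow> nat \<Rightarrow> nat"
      where "label q i = (if q i \<noteq> Suc k \<and> (q i = 0 \<or> g i (pt q) \<ge> 0) then 0 else 1)" for q i
    have pt_C: "pt q \<in> C" if "\<forall>i<n. q i \<le> Suc k" for q
      using that by (auto simp: C_iff pt_def divide_le_eq)
    have label_0: "g i (pt q) \<ge> 0" if "\<forall>i<n. q i \<le> Suc k" "i < n" "label q i = 0" for q i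
      using that low[OF \<open>i < n\<close> pt_C[OF that(1)]] by (auto simp: label_def pt_def split: if_splits)
    have label_1: "g i (pt q) \<le> 0" if "\<forall>i<n. q i \<le> Suc k" "i < n" "label q i \<noteq> 0" for q i
      using that high[OF \<open>i < n\<close> pt_C[OF that(1)]] by (auto simp: label_def pt_def split: if_splits)
    obtain q where q: "\<forall>i<n. q i < Suc k"
      "\<forall>i<n. \<exists>r s. (\<forall>j<n. q j \<le> r j \<and> r j \<le> q j + 1) \<and>
         (\<forall>j<n. q j \<le> s j \<and> s j \<le> q j + 1) \<and> label r i \<noteq> label s i"
      by (rule kuhn_lemma[of "Suc k" n label]) (auto simp: label_def)
    have near: "\<bar>pt r j - pt q j\<bar> \<le> 1 / Suc k" if "\<forall>j<n. q j \<le> r j \<and> r j \<le> q j + 1" for r j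
    proof (cases "j < n")
      case True
      then have "real (r j) - real (q j) \<le> 1" "real (r j) - real (q j) \<ge> 0"
        using that by (auto simp: of_nat_diff simp flip: of_nat_Suc)
      then show ?thesis
        using True by (simp add: pt_def divide_right_mono flip: diff_divide_distrib)
    qed (simp add: pt_def)
    show ?thesis
    proof (rule bexI[of _ "pt q"], intro allI impI)
      fix i assume i: "i < n"
      then obtain r s where rs: "\<forall>j<n. q j \<le> r j \<and> r j \<le> q j + 1"
        "\<forall>j<n. q j \<le> s j \<and> s j \<le> q j + 1" "label r i \<noteq> label s i"
        using q by blast
      have in_grid: "\<forall>i<n. r i \<le> Suc k" "\<forall>i<n. s i \<le> Suc k"
        using rs q(1) by (fastforce intro: order_trans)+
      show "\<exists>a\<in>C. \<exists>b\<in>C. g i a \<ge> 0 \<and> g i b \<le> 0 \<and>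
          (\<forall>j. \<bar>a j - pt q j\<bar> \<le> 1 / Suc k \<and> \<bar>b j - pt q j\<bar> \<le> 1 / Suc k)"
      proof (cases "label r i = 0")
        case True
        then show ?thesis
          using rs in_grid i label_0[of r i] label_1[of s i] near[of r] near[of s] pt_C[of r] pt_C[of s]
          by metis
      next
        case False
        then have "label s i = 0" using rs(3) by (auto simp: label_def split: if_splits)
        with False show ?thesis
          using rs in_grid i label_0[of s i] label_1[of r i] near[of r] near[of s] pt_C[of r] pt_C[of s]
          by metis
      qed
    next
      show "pt q \<in> C" using q(1) by (intro pt_C) (auto intro: less_imp_le)
    qed
  qed
  then obtain z where z: "\<And>k. z k \<in> C" and "\<forall>k. \<forall>i<n. \<exists>a\<in>C. \<exists>b\<in>C. g i a \<ge> 0 \<and> g i b \<le> 0 \<and>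
      (\<forall>j. \<bar>a j - z k j\<bar> \<le> 1 / Suc k \<and> \<bar>b j - z k j\<bar> \<le> 1 / Suc k)"
    by metis
  then have "\<forall>i k. \<exists>a b. i < n \<longrightarrow> a \<in> C \<and> b \<in> C \<and> g i a \<ge> 0 \<and> g i b \<le> 0 \<and>
      (\<forall>j. \<bar>a j - z k j\<bar> \<le> 1 / Suc k \<and> \<bar>b j - z k j\<bar> \<le> 1 / Suc k)"
    by blast
  then obtain a b where ab:
    "\<And>i k. i < n \<Longrightarrow> a i k \<in> C \<and> b i k \<in> C \<and> g i (a i k) \<ge> 0 \<and> g i (b i k) \<le> 0 \<and>
      (\<forall>j. \<bar>a i k j - z k j\<bar> \<le> 1 / Suc k \<and> \<bar>b i k j - z k j\<bar> \<le> 1 / Suc k)"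
    unfolding choice_iff by blast
  have "compactin (product_topology (\<lambda>_. euclideanreal) (UNIV :: nat set)) C"
    by (auto simp: C_def compactin_PiE)
  then have "compact C"
    by (simp add: euclidean_product_topology)
  then obtain x r where x: "x \<in> C" and r: "strict_mono r" "(z \<circ> r) \<longlonglongrightarrow> x"
    using z unfolding compact_eq_seq_compact_metric seq_compact_def by metis
  \<comment> \<open>Convergence in the product topology is coordinatewise, so the sign witnesses
    \<open>a i\<close> and \<open>b i\<close> share the limit of \<open>z\<close> along
    \<open>r\<close>.\<close>
  have lim: "(\<lambda>k. u (r k)) \<longlonglongrightarrow> x"
    if near: "\<And>k j. \<bar>u k j - z k j\<bar> \<le> 1 / Suc k" for u :: "nat \<Rightarrow> nat \<Rightarrow> real"
  proof -
    have "(\<lambda>k. u (r k) j) \<longlonglongrightarrow> x j" for j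
    proof -
      have "(\<lambda>k. z (r k) j) \<longlonglongrightarrow> x j"
        using r(2) limitin_componentwise[of "\<lambda>_::nat. euclideanreal" UNIV "z \<circ> r" x sequentially]
        by (simp add: euclidean_product_topology o_def)
      moreover have "(\<lambda>k. u k j - z k j) \<longlonglongrightarrow> 0"
        by (rule Lim_null_comparison[OF always_eventually LIMSEQ_Suc[OF lim_1_over_n]])
           (use near in auto)
      then have "(\<lambda>k. u (r k) j - z (r k) j) \<longlonglongrightarrow> 0"
        using LIMSEQ_subseq_LIMSEQ[OF _ r(1)] by (force simp: o_def)
      ultimately show ?thesis
        using tendsto_add by fastforce
    qed
    then show ?thesis
      using limitin_componentwise[of "\<lambda>_::nat. euclideanreal" UNIV "\<lambda>k. u (r k)" x sequentially]
      by (simp add: euclidean_product_topology)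
  qed
  have "g i x = 0" if i: "i < n" for i
  proof -
    have conv: "(\<lambda>k. g i (u (r k))) \<longlonglongrightarrow> g i x"
      if "\<And>k. u k \<in> C" "\<And>k j. \<bar>u k j - z k j\<bar> \<le> 1 / Suc k" for u
      using continuous_on_tendsto_compose[OF cont[OF i] lim[OF that(2)] x] that(1) by simp
    have "0 \<le> g i x"
      by (rule LIMSEQ_le_const[OF conv[of "a i"]]) (use ab i in auto)
    moreover have "g i x \<le> 0"
      by (rule LIMSEQ_le_const2[OF conv[of "b i"]]) (use ab i in auto)
    ultimately show ?thesis by simp
  qed
  with x show ?thesis by blast
qed

section \<open>Coordinates and continuity in geometric realizations\<close>

lemma realization_set_Pow_iff:
  "k \<in> realization_set (Pow N) N \<longleftrightarrow> k \<in> extensional N \<and> (\<forall>v\<in>N. 0 \<le> k v) \<and> (\<Sum>v\<in>N. k v) = 1"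
  by (auto simp: realization_set_def pos_support_def PiE_iff)

lemma topspace_geometric_realization [simp]:
  "topspace (geometric_realization K V) = realization_set K V"
  by (auto simp: geometric_realization_def realization_set_def PiE_iff extensional_def)

text \<open>Universal property of the product topology; extensionality comes with membership in
  \<open>realization_set\<close>.\<close>

lemma continuous_map_into_geometric_realization:
  "continuous_map X (geometric_realization K V) f \<longleftrightarrow>
     (\<forall>x\<in>topspace X. f x \<in> realization_set K V) \<and>
     (\<forall>v\<in>V. continuous_map X euclideanreal (\<lambda>x. f x v))"
  by (auto simp: geometric_realization_def continuous_map_in_subtopology
      continuous_map_componentwise realization_set_def PiE_iff)

lemma continuous_map_geometric_realization_coordinate:
  "v \<in> V \<Longrightarrow> continuous_map (geometric_realization K V) euclideanreal (\<lambda>k. k v)"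
  using continuous_map_into_geometric_realization[of "geometric_realization K V" K V id]
  by simp

section \<open>Brouwer for the simplex and surjectivity of face-preserving maps\<close>

text \<open>A zero of the displacement \<open>\<phi> (\<rho> x) - x\<close> on the cube, supplied by
  \<open>poincare_miranda\<close>, yields the fixed point. The sign conditions on opposite faces
  hold since simplex coordinates lie between 0 and 1.\<close>

theorem brouwer_simplex:
  assumes "finite N" "N \<noteq> {}"
    and \<phi>: "continuous_map (geometric_realization (Pow N) N) (geometric_realization (Pow N) N) \<phi>"
  shows "\<exists>x\<in>realization_set (Pow N) N. \<phi> x = x"
proof -
  define C where "C = (UNIV :: nat set) \<rightarrow>\<^sub>E {0..1::real}"
  define n where "n = card N"
  have n: "n > 0" using assms by (simp add: n_def card_gt_0_iff)
  obtain e where e: "bij_betw e N {..<n}"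
    unfolding n_def using assms(1) by (metis ex_bij_betw_finite_nat atLeast0LessThan)
  define E where "E x = (\<lambda>v\<in>N. x (e v))" for x :: "nat \<Rightarrow> real"
  define s where "s x = (\<Sum>v\<in>N. x (e v))" for x :: "nat \<Rightarrow> real"
  \<comment> \<open>A retraction of the cube onto the simplex: points below the simplex are translated along
    the diagonal, points above it are rescaled.\<close>
  define \<rho> where "\<rho> x = (\<lambda>v\<in>N. (x (e v) + max 0 (1 - s x) / n) / max 1 (s x))" for x
  have C_iff: "x \<in> C \<longleftrightarrow> (\<forall>i. 0 \<le> x i \<and> x i \<le> 1)" for x
    by (auto simp: C_def PiE_iff)
  have \<rho>_in: "\<rho> x \<in> realization_set (Pow N) N" if "x \<in> C" for x
  proof -
    have "(\<Sum>v\<in>N. \<rho> x v) = (s x + n * (max 0 (1 - s x) / n)) / max 1 (s x)"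
      by (simp add: \<rho>_def s_def n_def sum.distrib flip: sum_divide_distrib)
    also have "\<dots> = 1" using n by (auto simp: max_def)
    finally show ?thesis
      using that by (auto simp: realization_set_Pow_iff \<rho>_def C_iff)
  qed
  have coord: "continuous_map (top_of_set C) euclideanreal (\<lambda>x. x j)" for j
    by (auto intro: continuous_on_subset continuous_on_coordinatewise_then_product
        continuous_on_product_then_coordinatewise[OF continuous_on_id])
  have cont_s: "continuous_map (top_of_set C) euclideanreal s"
    unfolding s_def by (intro continuous_map_sum coord assms(1))
  have "continuous_map (top_of_set C) euclideanreal
      (\<lambda>x. (x j + max 0 (1 - s x) / n) / max 1 (s x))" for j
    by (intro continuous_map_real_divide continuous_map_add continuous_map_real_max
        continuous_map_diff coord cont_s) (use n in auto)
  then have "continuous_map (top_of_set C) (geometric_realization (Pow N) N) \<rho>"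
    using \<rho>_in by (auto simp: continuous_map_into_geometric_realization \<rho>_def)
  then have \<phi>\<rho>: "continuous_map (top_of_set C) (geometric_realization (Pow N) N) (\<phi> \<circ> \<rho>)"
    using \<phi> continuous_map_compose by blast
  have \<phi>_in: "\<phi> (\<rho> x) \<in> realization_set (Pow N) N" if "x \<in> C" for x
    using \<phi>\<rho> that by (auto simp: continuous_map_into_geometric_realization)
  have \<phi>_bounds: "0 \<le> \<phi> (\<rho> x) v" "\<phi> (\<rho> x) v \<le> 1" if "x \<in> C" "v \<in> N" for x v
    using \<phi>_in[OF that(1)] member_le_sum[of v N "\<phi> (\<rho> x)"] that assms(1)
    by (auto simp: realization_set_Pow_iff)
  define e' where "e' = inv_into N e"
  have e': "e' i \<in> N" "e (e' i) = i" if "i < n" for i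
    using e that unfolding e'_def bij_betw_def by (auto intro: inv_into_into f_inv_into_f)
  have "\<exists>x\<in>C. \<forall>i<n. \<phi> (\<rho> x) (e' i) - x i = 0"
    unfolding C_def
  proof (rule poincare_miranda; fold C_def)
    fix i assume "i < n"
    then have "continuous_map (top_of_set C) euclideanreal (\<lambda>x. \<phi> (\<rho> x) (e' i) - x i)"
      using \<phi>\<rho> e'(1) by (intro continuous_map_diff coord)
        (auto simp: continuous_map_into_geometric_realization)
    then show "continuous_on C (\<lambda>x. \<phi> (\<rho> x) (e' i) - x i)" by simp
  qed (use \<phi>_bounds e' in auto)
  then obtain x where x: "x \<in> C" "\<And>i. i < n \<Longrightarrow> \<phi> (\<rho> x) (e' i) = x i" by auto
  have fix_coord: "\<phi> (\<rho> x) v = x (e v)" if "v \<in> N" for v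
    using x(2)[of "e v"] e that by (auto simp: e'_def bij_betw_def)
  \<comment> \<open>The zero has the coordinates of a simplex point, so both \<open>max\<close>
    terms in \<open>\<rho>\<close> are neutral and \<open>\<rho> x\<close> has the same
    coordinates.\<close>
  then have "s x = 1"
    using \<phi>_in[OF x(1)] by (simp add: s_def realization_set_Pow_iff)
  then have "\<phi> (\<rho> x) = \<rho> x"
    using \<phi>_in[OF x(1)] fix_coord
    by (intro extensionalityI[of _ N]) (auto simp: \<rho>_def realization_set_Pow_iff)
  with \<rho>_in[OF x(1)] show ?thesis by blast
qed

text \<open>Brouwer is applied to a map that shifts mass towards the coordinates where
  \<open>g x\<close> falls short of \<open>y\<close>. At a fixed point no shortfall can remain, and
  equal total mass then gives \<open>g x = y\<close>.\<close>

theorem face_preserving_map_onto: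
  assumes "finite N"
    and g: "continuous_map (geometric_realization (Pow N) N) (geometric_realization (Pow N) N) g"
    and face: "\<And>x. x \<in> realization_set (Pow N) N \<Longrightarrow> pos_support N (g x) \<subseteq> pos_support N x"
    and y: "y \<in> realization_set (Pow N) N"
  shows "\<exists>x\<in>realization_set (Pow N) N. g x = y"
proof -
  let ?\<Delta> = "realization_set (Pow N) N"
  have "N \<noteq> {}" using y by (auto simp: realization_set_Pow_iff)
  have g_in: "g x \<in> ?\<Delta>" if "x \<in> ?\<Delta>" for x
    using g that by (auto simp: continuous_map_into_geometric_realization)
  define d where "d x v = max 0 (y v - g x v)" for x v
  define S where "S x = (\<Sum>v\<in>N. d x v)" for x
  \<comment> \<open>A fixed point satisfies \<open>x v * S x = d x v\<close>. If \<open>S x > 0\<close>, then \<open>g x \<le> y\<close>: on the support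
    of \<open>x\<close> because \<open>d x v > 0\<close>, off it because \<open>g x\<close> vanishes there.\<close>
  define \<phi> where "\<phi> x = (\<lambda>v\<in>N. (x v + d x v) / (1 + S x))" for x
  have d_nonneg: "d x v \<ge> 0" for x v by (simp add: d_def)
  have S_nonneg: "S x \<ge> 0" for x by (simp add: S_def d_nonneg sum_nonneg)
  have \<phi>_in: "\<phi> x \<in> ?\<Delta>" if "x \<in> ?\<Delta>" for x
  proof -
    have "(\<Sum>v\<in>N. \<phi> x v) = (1 + S x) / (1 + S x)"
      using that by (simp add: \<phi>_def S_def realization_set_Pow_iff sum.distrib flip: sum_divide_distrib)
    then show ?thesis
      using that S_nonneg[of x] d_nonneg by (auto simp: realization_set_Pow_iff \<phi>_def)
  qed
  let ?T = "geometric_realization (Pow N) N"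
  have cont_d: "continuous_map ?T euclideanreal (\<lambda>x. d x v)" if "v \<in> N" for v
    unfolding d_def using g that
    by (intro continuous_map_real_max continuous_map_diff)
       (auto simp: continuous_map_into_geometric_realization)
  have cont_S: "continuous_map ?T euclideanreal S"
    unfolding S_def by (intro continuous_map_sum cont_d assms(1))
  have "continuous_map ?T euclideanreal (\<lambda>x. (x v + d x v) / (1 + S x))" if "v \<in> N" for v
    by (intro continuous_map_real_divide continuous_map_add cont_d cont_S that
        continuous_map_geometric_realization_coordinate)
       (use S_nonneg in \<open>auto simp: add_nonneg_eq_0_iff\<close>)
  then have "continuous_map ?T ?T \<phi>"
    using \<phi>_in by (auto simp: continuous_map_into_geometric_realization \<phi>_def)
  then obtain x where x: "x \<in> ?\<Delta>" "\<phi> x = x"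
    using brouwer_simplex[OF assms(1) \<open>N \<noteq> {}\<close>] by blast
  have xS: "x v * S x = d x v" if "v \<in> N" for v
  proof -
    have "x v = (x v + d x v) / (1 + S x)"
      using fun_cong[OF x(2), of v] that by (simp add: \<phi>_def)
    then show ?thesis using S_nonneg[of x] by (simp add: field_simps)
  qed
  have sums: "(\<Sum>v\<in>N. g x v) = (\<Sum>v\<in>N. y v)"
    using g_in[OF x(1)] y by (simp add: realization_set_Pow_iff)
  have "S x = 0"
  proof (rule ccontr)
    assume "S x \<noteq> 0"
    have le: "g x v \<le> y v" if v: "v \<in> N" for v
    proof (cases "x v > 0")
      case True
      then have "d x v > 0" using xS[OF v] S_nonneg[of x] \<open>S x \<noteq> 0\<close>
        by (metis less_eq_real_def mult_pos_pos)
      then show ?thesis by (auto simp: d_def)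
    next
      case False
      then have "\<not> g x v > 0" using face[OF x(1)] v by (auto simp: pos_support_def)
      then show ?thesis using y v by (force simp: realization_set_Pow_iff)
    qed
    \<comment> \<open>Domination with equal sums is equality, so the total shortfall vanishes after
      all.\<close>
    have "g x v = y v" if "v \<in> N" for v
      using sum_mono_inv[OF sums le that assms(1)] .
    then have "S x = 0" by (simp add: S_def d_def)
    with \<open>S x \<noteq> 0\<close> show False by simp
  qed
  then have le: "y v \<le> g x v" if "v \<in> N" for v
    using xS[OF that] by (simp add: d_def)
  have "g x v = y v" if "v \<in> N" for v
    using sum_mono_inv[OF sums[symmetric] le that assms(1)] by simp
  then have "g x = y"
    using g_in[OF x(1)] y
    by (intro extensionalityI[of _ N]) (auto simp: realization_set_Pow_iff)
  with x(1) show ?thesis by blast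
qed

section \<open>The weighted average of the colorings and its preimage of the barycenter\<close>

theorem theorem2p1:
  fixes N :: "'b set" and K :: "'a set set" and V :: "'a set"
    and f :: "'a set \<Rightarrow> 'b set"
    and I :: "'i set" and c :: "'i \<Rightarrow> 'a set \<Rightarrow> 'b set" and m :: "'i \<Rightarrow> nat"
  assumes "finite N"
    and "finite_simplicial_complex K V"
    and "subdivision K V (Pow N) N f"
    and "finite I" and "I \<noteq> {}"
    and "\<And>i. i \<in> I \<Longrightarrow> sperner_coloring K V (Pow N) N f (c i)"
    and "int (\<Sum>i\<in>I. m i) = int (card N) - 1"
  shows "\<exists>\<sigma>\<in>K. (\<forall>i\<in>I. card (c i \<sigma>) > m i) \<and> (\<Union>i\<in>I. c i \<sigma>) = N"
proof -
  let ?T = "geometric_realization K V" and ?\<Delta> = "geometric_realization (Pow N) N"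
  define n where "n = real (card N)"
  have sum_m: "(\<Sum>i\<in>I. real (m i)) = n - 1"
  proof -
    have "(\<Sum>i\<in>I. m i) + 1 = card N" using assms(7) by linarith
    then show ?thesis by (simp add: n_def flip: of_nat_sum)
  qed
  \<comment> \<open>A sum of naturals equal to \<open>card N - 1\<close> over the integers rules out
    an empty \<open>N\<close>.\<close>
  have "n > 0" using assms(7) by (simp add: n_def del: of_nat_sum)
  have "finite V" using assms(2) by (simp add: finite_simplicial_complex_def)
  obtain h where h: "homeomorphic_map ?T ?\<Delta> h"
    and h_supp: "\<And>k. k \<in> realization_set K V \<Longrightarrow> pos_support N (h k) = f (pos_support V k)"
    using assms(3) by (auto simp: subdivision_def)
  obtain h' where h'_cont: "continuous_map ?\<Delta> ?T h'"
    and hh': "\<And>x. x \<in> realization_set (Pow N) N \<Longrightarrow> h (h' x) = x"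
    using h unfolding homeomorphic_map_maps homeomorphic_maps_def by auto
  have h'_in: "h' x \<in> realization_set K V" if "x \<in> realization_set (Pow N) N" for x
    using h'_cont that by (auto simp: continuous_map_into_geometric_realization)
  have "\<forall>i\<in>I. \<exists>c0\<in>V \<rightarrow> N. \<forall>A\<in>K. c i A = c0 ` A"
    using assms(6) by (auto simp: sperner_coloring_def simplicial_map_on_def)
  then obtain c0 where c0: "\<And>i v. i \<in> I \<Longrightarrow> v \<in> V \<Longrightarrow> c0 i v \<in> N"
    and c_eq: "\<And>i A. i \<in> I \<Longrightarrow> A \<in> K \<Longrightarrow> c i A = c0 i ` A"
    by (metis funcset_mem)
  \<comment> \<open>The numerators sum to \<open>(n - 1) + 1 = n\<close>, giving total weight 1; the
    share \<open>1 / card I\<close> makes each weight strictly exceed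
    \<open>m i / n\<close>.\<close>
  define t where "t i = (m i + 1 / card I) / n" for i
  have "card I > 0" using assms(4,5) by (simp add: card_gt_0_iff)
  have t_gt: "m i / n < t i" for i
    using \<open>card I > 0\<close> \<open>n > 0\<close> by (simp add: t_def divide_strict_right_mono)
  then have t_pos: "t i > 0" for i
    using \<open>n > 0\<close> by (meson divide_nonneg_pos le_less_trans of_nat_0_le_iff)
  have t_sum: "(\<Sum>i\<in>I. t i) = 1"
    using \<open>card I > 0\<close> \<open>n > 0\<close> sum_m
    by (simp add: t_def sum.distrib flip: sum_divide_distrib)
  \<comment> \<open>Barycentric coordinate at \<open>v\<close> of the affine extension of
    \<open>c0 i\<close>: each vertex \<open>w\<close> carries its mass \<open>k w\<close> to
    \<open>c0 i w\<close>.\<close>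
  define a where "a k i v = (\<Sum>w | w \<in> V \<and> c0 i w = v. k w)" for k :: "'a \<Rightarrow> real" and i v
  define G where "G k = (\<lambda>v\<in>N. \<Sum>i\<in>I. t i * a k i v)" for k
  have pos_support_K: "pos_support V k \<in> K" and k_nonneg: "w \<in> V \<Longrightarrow> k w \<ge> 0"
    and k_sum: "(\<Sum>w\<in>V. k w) = 1" if "k \<in> realization_set K V" for k w
    using that by (auto simp: realization_set_def PiE_iff)
  have a_nonneg: "a k i v \<ge> 0" if "k \<in> realization_set K V" for k i v
    unfolding a_def using k_nonneg[OF that] by (intro sum_nonneg) auto
  \<comment> \<open>The fibres of \<open>c0 i\<close> partition \<open>V\<close>, so mass is only
    regrouped.\<close>
  have a_sum: "(\<Sum>v\<in>N. a k i v) = 1" if "k \<in> realization_set K V" "i \<in> I" for k i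
    unfolding a_def k_sum[OF that(1), symmetric]
    using c0[OF that(2)] by (intro sum.group \<open>finite V\<close> assms(1)) auto
  have a_support: "v \<in> c i (pos_support V k)"
    if "k \<in> realization_set K V" "i \<in> I" "a k i v \<noteq> 0" for k i v
  proof -
    obtain w where w: "w \<in> V" "c0 i w = v" "k w \<noteq> 0"
      using \<open>a k i v \<noteq> 0\<close> unfolding a_def by (auto elim: sum.not_neutral_contains_not_neutral)
    then have "w \<in> pos_support V k"
      using k_nonneg[OF that(1), of w] by (simp add: pos_support_def)
    then show ?thesis
      using w c_eq[OF that(2) pos_support_K[OF that(1)]] by auto
  qed
  have G_support: "\<exists>i\<in>I. v \<in> c i (pos_support V k)"
    if "k \<in> realization_set K V" "v \<in> N" "G k v > 0" for k v
  proof -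
    have "(\<Sum>i\<in>I. t i * a k i v) \<noteq> 0" using that by (simp add: G_def)
    then obtain i where "i \<in> I" "a k i v \<noteq> 0"
      by (metis (no_types, lifting) mult_zero_right sum.neutral)
    then show ?thesis using a_support that by blast
  qed
  have G_in: "G k \<in> realization_set (Pow N) N" if "k \<in> realization_set K V" for k
  proof -
    have "(\<Sum>v\<in>N. G k v) = (\<Sum>i\<in>I. t i * (\<Sum>v\<in>N. a k i v))"
      unfolding G_def sum_distrib_left by (simp add: sum.swap[of _ N])
    also have "\<dots> = 1" using a_sum[OF that] t_sum by simp
    finally show ?thesis
      using a_nonneg[OF that] t_pos
      by (auto simp: realization_set_Pow_iff G_def less_imp_le intro!: sum_nonneg mult_nonneg_nonneg)
  qed
  have "continuous_map ?T euclideanreal (\<lambda>k. \<Sum>i\<in>I. t i * a k i v)" for v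
    unfolding a_def
    by (intro continuous_map_sum continuous_map_real_mult assms(4)
        continuous_map_geometric_realization_coordinate) (use \<open>finite V\<close> in auto)
  then have "continuous_map ?T ?\<Delta> G"
    using G_in by (auto simp: continuous_map_into_geometric_realization G_def)
  then have "continuous_map ?\<Delta> ?\<Delta> (G \<circ> h')"
    using h'_cont continuous_map_compose by blast
  \<comment> \<open>The Sperner condition enters here: colors positive in the average lie in
    \<open>f\<close> of the supporting face, which is the support of
    \<open>h (h' x) = x\<close>.\<close>
  moreover have "pos_support N ((G \<circ> h') x) \<subseteq> pos_support N x"
    if x: "x \<in> realization_set (Pow N) N" for x
  proof
    fix v assume "v \<in> pos_support N ((G \<circ> h') x)"
    then obtain i where i: "i \<in> I" "v \<in> c i (pos_support V (h' x))"
      using G_support[OF h'_in[OF x]] by (auto simp: pos_support_def)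
    then have "v \<in> f (pos_support V (h' x))"
      using assms(6)[OF i(1)] pos_support_K[OF h'_in[OF x]]
      by (auto simp: sperner_coloring_def specialization_def)
    then show "v \<in> pos_support N x"
      using h_supp[OF h'_in[OF x]] hh'[OF x] by simp
  qed
  moreover have "(\<lambda>v\<in>N. 1 / n) \<in> realization_set (Pow N) N"
    using \<open>n > 0\<close> by (auto simp: realization_set_Pow_iff n_def)
  ultimately obtain x where x: "x \<in> realization_set (Pow N) N" "(G \<circ> h') x = (\<lambda>v\<in>N. 1 / n)"
    using face_preserving_map_onto[OF assms(1)] by blast
  define k where "k = h' x"
  define \<sigma> where "\<sigma> = pos_support V k"
  have k: "k \<in> realization_set K V" and Gk: "\<And>v. v \<in> N \<Longrightarrow> G k v = 1 / n"
    using h'_in[OF x(1)] x(2) by (auto simp: k_def fun_eq_iff)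
  have "\<sigma> \<in> K" using pos_support_K[OF k] by (simp add: \<sigma>_def)
  have c_N: "c i \<sigma> \<subseteq> N" if "i \<in> I" for i
    using assms(6)[OF that] \<open>\<sigma> \<in> K\<close>
    by (auto simp: sperner_coloring_def simplicial_map_on_def complex_map_def)
  have "card (c i \<sigma>) > m i" if i: "i \<in> I" for i
  proof -
    \<comment> \<open>Row \<open>i\<close> has sum \<open>t i\<close>, lives on the columns in
      \<open>c i \<sigma>\<close>, and each entry is at most its column sum \<open>1 / n\<close>; so
      at least \<open>t i * n > m i\<close> columns are needed.\<close>
    have "t i = (\<Sum>v\<in>N. t i * a k i v)"
      using a_sum[OF k i] by (simp flip: sum_distrib_left)
    also have "\<dots> = (\<Sum>v\<in>c i \<sigma>. t i * a k i v)"
      using a_support[OF k i] c_N[OF i] assms(1)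
      by (intro sum.mono_neutral_right) (auto simp: \<sigma>_def)
    also have "\<dots> \<le> (\<Sum>v\<in>c i \<sigma>. 1 / n)"
    proof (rule sum_mono)
      fix v assume "v \<in> c i \<sigma>"
      then have "v \<in> N" using c_N[OF i] by auto
      have "t i * a k i v \<le> (\<Sum>i\<in>I. t i * a k i v)"
        using i assms(4) a_nonneg[OF k] t_pos
        by (intro member_le_sum) (auto simp: less_imp_le intro!: mult_nonneg_nonneg)
      also have "\<dots> = 1 / n"
        using Gk[OF \<open>v \<in> N\<close>] \<open>v \<in> N\<close> by (simp add: G_def)
      finally show "t i * a k i v \<le> 1 / n" .
    qed
    finally have "t i \<le> card (c i \<sigma>) / n" by simp
    with t_gt[of i] have "m i / n < card (c i \<sigma>) / n" by linarith
    then show ?thesis using \<open>n > 0\<close> by (simp add: divide_less_cancel)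
  qed
  \<comment> \<open>Every column sum \<open>1 / n\<close> is positive, so each column has a nonzero
    entry.\<close>
  moreover have "(\<Union>i\<in>I. c i \<sigma>) = N"
    using c_N G_support[OF k] Gk \<open>n > 0\<close> unfolding \<sigma>_def by fastforce
  ultimately show ?thesis using \<open>\<sigma> \<in> K\<close> by blast
qed

end
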